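(* Let $r\ge 3$ and $3\le t\le e-1$ be integers, and let $n$ be sufficiently large as a function of $e$ and $r$. Let $\mathcal{F}\subseteq\binom{[n]}{r}$ be an $r$-graph on the vertex set $[n]$ such that (a) $\mathcal{F}$ is $\mathscr{G}_r(er-2(e-1),e)$-free, and is $\mathscr{G}_r(ir-2(i-1)-1,i)$-free for all $t\le i\le e-1$; (b) for every vertex in $[n]$, the number of edges of $\mathcal{F}$ containing it is either $0$ or at least $e$. Moreover, assume that $$\frac{|\mathcal{F}|}{n^2}\ge\max\Big\{\frac{1}{r(r-1)}-\frac{\delta}{r(r-2)},\ \frac{1}{2r^2-2r-5}\Big\},\qquad\text{where }\delta=\frac{1}{(3r-4)(r-1)+1}.$$ Then there exists a subhypergraph $\mathcal{F}'\subseteq\mathcal{F}$ with the following properties: (i) $\mathcal{F}'$ is $\mathscr{G}_r((t-1)r-2(t-2)-1,t-1)$-free; (ii) $|V(\mathcal{F}')|\ge\alpha n$, where $\alpha=\sqrt{\frac{3r^2-4r-14}{3r^2+2r-8}}$; (iii) $\frac{|\mathcal{F}'|}{|V(\mathcal{F}')|^2}\ge\frac{|\mathcal{F}|}{n^2}$.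
   Context: $[n]=\{1,\ldots,n\}$ and $\binom{[n]}{r}$ is the set of all $r$-element subsets of $[n]$. An $r$-graph ($r$-uniform hypergraph) $\mathcal{H}$ on a vertex set $V(\mathcal{H})$ is a family of distinct $r$-element subsets of $V(\mathcal{H})$, called edges; $|\mathcal{H}|$ is the number of edges. A subhypergraph $\mathcal{F}'$ of $\mathcal{F}$ is an $r$-graph whose edges are edges of $\mathcal{F}$, with a vertex set $V(\mathcal{F}')\subseteq V(\mathcal{F})$ containing all edges of $\mathcal{F}'$. For positive integers $v,i$, an $r$-graph $\mathcal{H}$ is called $\mathscr{G}_r(v,i)$-free if for arbitrary $i$ distinct edges $A_1,\ldots,A_i\in\mathcal{H}$ one has $|\bigcup_{j=1}^i A_j|\ge v+1$ (vacuously true if $\mathcal{H}$ has fewer than $i$ edges). *)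

theory Defs
  imports Complex_Main "HOL-Library.Ramsey"
begin

text \<open>
  An \<open>r\<close>-graph is given by its vertex set \<open>V\<close> and its edge set \<open>H\<close>; isolated vertices are
  allowed, so \<open>V\<close> is not determined by \<open>H\<close>. The set of \<open>r\<close>-element subsets
  of \<open>V\<close> is \<open>nsets V r\<close>.
\<close>
definition r_graph :: "nat \<Rightarrow> 'a set \<Rightarrow> 'a set set \<Rightarrow> bool" where
  "r_graph r V H \<longleftrightarrow> finite V \<and> H \<subseteq> nsets V r"

definition subhypergraph :: "nat \<Rightarrow> 'a set \<Rightarrow> 'a set set \<Rightarrow> 'a set \<Rightarrow> 'a set set \<Rightarrow> bool" where
  "subhypergraph r V' H' V H \<longleftrightarrow> r_graph r V' H' \<and> V' \<subseteq> V \<and> H' \<subseteq> H"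

text \<open>
  \<open>G_free v i H\<close>: any \<open>i\<close> distinct edges of \<open>H\<close> span at least \<open>v + 1\<close> vertices
  (that is, an \<open>r\<close>-graph \<open>H\<close> is \<open>G\<^sub>r(v,i)\<close>-free). The uniformity \<open>r\<close> is a property of \<open>H\<close>,
  see \<open>r_graph\<close>, and is therefore not a parameter here. Meant for \<open>i \<ge> 1\<close>.
\<close>
definition G_free :: "nat \<Rightarrow> nat \<Rightarrow> 'a set set \<Rightarrow> bool" where
  "G_free v i H \<longleftrightarrow> (\<forall>S \<subseteq> H. card S = i \<longrightarrow> card (\<Union>S) \<ge> v + 1)"

definition vertex_degree :: "'a set set \<Rightarrow> 'a \<Rightarrow> nat" where
  "vertex_degree H x = card {A \<in> H. x \<in> A}"

definition delta :: "nat \<Rightarrow> real" where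
  "delta r = 1 / ((3 * real r - 4) * (real r - 1) + 1)"

definition alpha :: "nat \<Rightarrow> real" where
  "alpha r = sqrt ((3 * real r ^ 2 - 4 * real r - 14) / (3 * real r ^ 2 + 2 * real r - 8))"

end

theory Submission
  imports Defs "HOL-Library.Disjoint_Sets"
begin

text \<open>
  Write \<open>q = r - 2\<close>. Let \<open>S\<close> consist of \<open>t - 1\<close> edges spanning at most \<open>(t - 1) q + 1\<close> vertices, and
  put \<open>X = \<Union>S\<close>. If all degrees are at least \<open>e\<close>, then \<open>X\<close> has exactly \<open>(t - 1) q + 1\<close> vertices, every
  other edge meets \<open>X\<close> in at most one vertex, and an edge count on the components of these edges outside
  of \<open>X\<close> shows that at most \<open>n / q + O(1)\<close> edges meet \<open>X\<close>. Hence deleting \<open>X\<close> does not decrease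
  \<open>card F - \<kappa> (card V)\<^sup>2\<close> for a suitable constant \<open>\<kappa>\<close> below the density of \<open>F\<close>, and neither does
  deleting a vertex of degree less than \<open>e\<close>. A subhypergraph with the fewest vertices among those for
  which this quantity is at least its initial value therefore contains no such \<open>S\<close>, and its density is
  at least that of \<open>F\<close>. It has many vertices because freeness for \<open>e\<close> edges alone forces
  \<open>card F \<le> (card V)\<^sup>2 / (r\<^sup>2 - r - 3)\<close>: group the edges into components under sharing two vertices
  and count the pairs of vertices covered by each component.
\<close>

section \<open>Connected finite families and the partition into components\<close>

text \<open>Connectedness is encoded as a construction that attaches one element at a time. Rule
  induction then compares each new edge with the union of the earlier ones, and stopping early
  leaves a connected subfamily.\<close>

inductive linked :: "('b \<Rightarrow> 'b \<Rightarrow> bool) \<Rightarrow> 'b set \<Rightarrow> bool" for R where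
  single: "linked R {a}"
| insert: "linked R P \<Longrightarrow> a \<in> P \<Longrightarrow> R a b \<Longrightarrow> b \<notin> P \<Longrightarrow> linked R (insert b P)"

lemma linked_finite: "linked R P \<Longrightarrow> finite P"
  by (induction rule: linked.induct) auto

text \<open>Every size up to \<open>card K\<close> occurs during the construction of
  \<open>K\<close>. This serves to cut a large component down to exactly the number of edges that a
  freeness hypothesis speaks of.\<close>

lemma linked_subset_card:
  assumes "linked R K" "0 < j" "j \<le> card K"
  shows "\<exists>P\<subseteq>K. linked R P \<and> card P = j"
  using assms
proof (induction arbitrary: j rule: linked.induct)
  case (single a)
  then show ?case by (intro exI[of _ "{a}"]) (auto intro: linked.single)
next
  case (insert P a b)
  note fin = linked_finite[OF insert.hyps(1)]
  show ?case
  proof (cases "j \<le> card P")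
    case True
    then show ?thesis using insert.IH insert.prems by blast
  next
    case False
    then have "card (Set.insert b P) = j"
      using insert.prems insert.hyps fin by auto
    then show ?thesis using linked.insert[OF insert.hyps(1-4)] by blast
  qed
qed

text \<open>A linked subset \<open>K\<close> of maximum size has no \<open>R\<close>-neighbour in
  \<open>H - K\<close>, since adding one would enlarge it; induction splits \<open>H - K\<close>.
  Symmetry is needed for separation in both directions.\<close>

lemma linked_partition:
  assumes "finite H" and sym: "\<And>a b. R a b \<Longrightarrow> R b a"
  shows "\<exists>\<K>. partition_on H \<K> \<and> (\<forall>K\<in>\<K>. linked R K) \<and>
    (\<forall>K\<in>\<K>. \<forall>L\<in>\<K>. K \<noteq> L \<longrightarrow> (\<forall>a\<in>K. \<forall>b\<in>L. \<not> R a b))"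
  using assms(1)
proof (induction H rule: finite_psubset_induct)
  case (psubset H)
  show ?case
  proof (cases "H = {}")
    case True
    then show ?thesis by (intro exI[of _ "{}"]) (auto simp: partition_on_def)
  next
    case False
    then obtain a where "a \<in> H" by blast
    define Q where "Q = (\<lambda>K. K \<subseteq> H \<and> linked R K)"
    have "Q {a}" using \<open>a \<in> H\<close> by (auto simp: Q_def intro: linked.single)
    moreover have "\<forall>K. Q K \<longrightarrow> card K < Suc (card H)"
      using psubset.hyps by (auto simp: Q_def less_Suc_eq_le intro: card_mono)
    ultimately obtain K where K: "Q K" and max: "\<And>L. Q L \<Longrightarrow> card L \<le> card K"
      using ex_has_greatest_nat[of Q "{a}" card] by blast
    have fK: "finite K" using K linked_finite Q_def by blast
    have "K \<noteq> {}" using max[OF \<open>Q {a}\<close>] by auto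
    have out: "\<not> R x b" if "x \<in> K" "b \<in> H - K" for x b
    proof
      assume "R x b"
      then have "Q (Set.insert b K)" using that K by (auto simp: Q_def intro: linked.insert)
      from max[OF this] show False using that fK by auto
    qed
    have "H - K \<subset> H" using K \<open>K \<noteq> {}\<close> by (auto simp: Q_def)
    from psubset.IH[OF this] obtain \<K> where P: "partition_on (H - K) \<K>"
      and L: "\<forall>K\<in>\<K>. linked R K"
      and sep: "\<forall>K\<in>\<K>. \<forall>L\<in>\<K>. K \<noteq> L \<longrightarrow> (\<forall>a\<in>K. \<forall>b\<in>L. \<not> R a b)"
      by blast
    have U: "\<Union>\<K> = H - K" using P by (auto simp: partition_on_def)
    have "partition_on H (Set.insert K \<K>)"
      using P K \<open>K \<noteq> {}\<close> unfolding partition_on_def Q_def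
      by (auto simp: disjoint_def)
    moreover have "\<forall>L\<in>Set.insert K \<K>. linked R L" using L K by (auto simp: Q_def)
    moreover have "\<not> R x y" if "A \<in> Set.insert K \<K>" "B \<in> Set.insert K \<K>" "A \<noteq> B" "x \<in> A" "y \<in> B"
      for A B x y
      using that out sep U sym by (metis Union_iff insert_iff)
    ultimately show ?thesis by (intro exI[of _ "Set.insert K \<K>"]) blast
  qed
qed

section \<open>Vertices and vertex pairs covered by a linked family of edges\<close>

text \<open>The first edge has \<open>q + 2\<close> vertices; every later one shares two with an
  earlier edge and so contributes at most \<open>q\<close> new ones.\<close>

lemma linked_Union_card_le:
  assumes "linked (\<lambda>A B. 2 \<le> card (A \<inter> B)) P" "\<forall>A\<in>P. finite A \<and> card A = q + 2"
  shows "card (\<Union>P) \<le> card P * q + 2"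
  using assms
proof (induction rule: linked.induct)
  case (single a)
  then show ?case by simp
next
  case (insert P a b)
  have fP: "finite P" using insert.hyps linked_finite by blast
  then have fU: "finite (\<Union>P)" using insert.prems by auto
  have fb: "finite b" using insert.prems by auto
  have "card (a \<inter> b) \<le> card (b \<inter> \<Union>P)" using insert.hyps fb by (intro card_mono) auto
  then have "2 \<le> card (b \<inter> \<Union>P)" using insert.hyps by linarith
  moreover have "card b + card (\<Union>P) = card (b \<union> \<Union>P) + card (b \<inter> \<Union>P)"
    using card_Un_Int[OF fb fU] .
  moreover have "card b = q + 2" using insert.prems by auto
  moreover have "card (\<Union>P) \<le> card P * q + 2" using insert by auto
  ultimately show ?case using insert.hyps fP by simp
qed

definition shadow2 :: "'a set set \<Rightarrow> 'a set set" where
  "shadow2 P = (\<Union>A\<in>P. nsets A 2)"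

text \<open>A pair of \<open>b\<close> that is already covered lies inside
  \<open>b \<inter> \<Union>P\<close>. The converse may fail, hence only an inequality.\<close>

lemma shadow2_insert_card:
  assumes "finite P" "\<forall>A\<in>P. finite A" "finite b"
  shows "card (shadow2 P) + (card b choose 2) \<le> card (shadow2 (insert b P)) + (card (b \<inter> \<Union>P) choose 2)"
proof -
  have f1: "finite (shadow2 P)" using assms by (auto simp: shadow2_def finite_imp_finite_nsets)
  have f2: "finite (nsets b 2)" using assms by (auto simp: finite_imp_finite_nsets)
  have "card (shadow2 P) + card (nsets b 2) = card (shadow2 P \<union> nsets b 2) + card (shadow2 P \<inter> nsets b 2)"
    using card_Un_Int[OF f1 f2] .
  moreover have "shadow2 P \<union> nsets b 2 = shadow2 (insert b P)" by (auto simp: shadow2_def)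
  moreover have "card (shadow2 P \<inter> nsets b 2) \<le> card (nsets (b \<inter> \<Union>P) 2)"
    using assms by (intro card_mono) (auto simp: shadow2_def nsets_def intro!: finite_imp_finite_nsets)
  ultimately show ?thesis by (simp add: card_nsets)
qed

text \<open>Adding an edge that meets the old ones in \<open>s \<ge> 2\<close> vertices increases the defect
  \<open>card P * q + 2 - card (\<Union>P)\<close> by \<open>s - 2\<close> and the shadow by at least
  \<open>(q + 2 choose 2) - (s choose 2)\<close>; the defect stays at most 1, so \<open>s \<le> 3\<close>.\<close>
lemma linked_shadow2:
  assumes "linked (\<lambda>A B. 2 \<le> card (A \<inter> B)) P" "\<forall>A\<in>P. finite A \<and> card A = q + 2"
    and "card P * q + 1 \<le> card (\<Union>P)"
  shows "card P * (q + 2 choose 2) + 2 * card (\<Union>P) \<le> card (shadow2 P) + card P + 2 * (card P * q) + 3"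
  using assms
proof (induction rule: linked.induct)
  case (single a)
  then show ?case by (simp add: shadow2_def card_nsets)
next
  case (insert P a b)
  have fP: "finite P" using insert.hyps linked_finite by blast
  then have fU: "finite (\<Union>P)" using insert.prems by auto
  have fb: "finite b" and cb: "card b = q + 2" using insert.prems by auto
  define s where "s = card (b \<inter> \<Union>P)"
  have "card (a \<inter> b) \<le> s" unfolding s_def using insert.hyps fb by (intro card_mono) auto
  then have s2: "2 \<le> s" using insert.hyps by linarith
  have u': "card b + card (\<Union>P) = card (b \<union> \<Union>P) + s"
    unfolding s_def using card_Un_Int[OF fb fU] .
  have u: "card (\<Union>P) \<le> card P * q + 2"
    using insert by (intro linked_Union_card_le) auto
  have k: "card (insert b P) = Suc (card P)" using insert.hyps fP by simp
  have low: "Suc (card P) * q + 1 \<le> card (b \<union> \<Union>P)" using insert.prems k by simp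
  have "s \<le> 3" using low u' u cb by simp
  moreover have "3 choose 2 = (3::nat)" by (simp add: choose_two)
  moreover have "s = 2 \<or> s = 3" using s2 \<open>s \<le> 3\<close> by linarith
  ultimately have ch: "(s choose 2) + 3 \<le> 2 * s" by auto
  have "card P * q + 1 \<le> card (\<Union>P)" using low u' s2 cb by simp
  then have "card P * (q + 2 choose 2) + 2 * card (\<Union>P) \<le> card (shadow2 P) + card P + 2 * (card P * q) + 3"
    using insert by auto
  moreover have "card (shadow2 P) + (q + 2 choose 2) \<le> card (shadow2 (insert b P)) + (s choose 2)"
    using shadow2_insert_card[of P b] fP insert.prems fb cb unfolding s_def by auto
  moreover have "\<Union>(insert b P) = b \<union> \<Union>P" by simp
  ultimately show ?case using ch u' cb k by simp
qed

text \<open>Doubling \<open>linked_shadow2\<close> leaves an error of \<open>2 * card P + 2\<close>,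
  which is at most \<open>3 * card P\<close> for two or more edges. A single edge spans one vertex
  more than assumed, and this removes the error.\<close>

lemma linked_card_le_shadow2:
  assumes "linked (\<lambda>A B. 2 \<le> card (A \<inter> B)) P" "\<forall>A\<in>P. finite A \<and> card A = q + 2"
    and "card P * q + 1 \<le> card (\<Union>P)"
  shows "card P * ((q + 2) * (q + 1)) \<le> 2 * card (shadow2 P) + 3 * card P"
proof -
  have "2 * (q + 2 choose 2) = (q + 2) * (q + 1)" by (simp add: choose_two)
  then have "card P * ((q + 2) * (q + 1)) = 2 * (card P * (q + 2 choose 2))" by (metis mult.left_commute)
  moreover have "card P = 1 \<Longrightarrow> card (\<Union>P) = card P * q + 2"
    using assms(2) by (auto simp: card_1_singleton_iff)
  moreover have "card P \<noteq> 0"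
    using assms(1) linked_finite[OF assms(1)] by (auto elim: linked.cases)
  ultimately show ?thesis using linked_shadow2[OF assms] assms(3) by linarith
qed

section \<open>Upper bound on the number of edges from freeness for \<open>e\<close> edges\<close>

lemma sum_card_le_card_UN:
  assumes "finite U" "finite I" "\<And>i. i \<in> I \<Longrightarrow> f i \<subseteq> U"
    and "\<And>i j. i \<in> I \<Longrightarrow> j \<in> I \<Longrightarrow> i \<noteq> j \<Longrightarrow> f i \<inter> f j = {}"
  shows "(\<Sum>i\<in>I. card (f i)) \<le> card U"
proof -
  have "(\<Sum>i\<in>I. card (f i)) = card (\<Union>i\<in>I. f i)"
    using assms by (intro card_UN_disjoint[symmetric]) (auto intro: finite_subset)
  also have "\<dots> \<le> card U" using assms by (intro card_mono) auto
  finally show ?thesis .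
qed

text \<open>Defects add up over a disjoint union of linked families after subtracting 2 for each but one of
  them, so defects of at least 2 never get lost; the last family is cut to the required size.\<close>
lemma dense_linked_families_subset:
  assumes "finite \<D>" "disjoint \<D>"
    and "\<forall>K\<in>\<D>. linked (\<lambda>A B. 2 \<le> card (A \<inter> B)) K \<and> card (\<Union>K) \<le> card K * q"
    and "\<forall>A\<in>\<Union>\<D>. finite A \<and> card A = q + 2"
  shows "card (\<Union>(\<Union>\<D>)) \<le> card (\<Union>\<D>) * q \<and>
    (\<forall>j \<le> card (\<Union>\<D>). \<exists>P\<subseteq>\<Union>\<D>. card P = j \<and> card (\<Union>P) \<le> j * q + 2)"
  using assms
proof (induction \<D> rule: finite_induct)
  case empty
  then show ?case by simp
next
  case (insert K \<D>)
  have IH: "card (\<Union>(\<Union>\<D>)) \<le> card (\<Union>\<D>) * q"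
    "\<forall>j \<le> card (\<Union>\<D>). \<exists>P\<subseteq>\<Union>\<D>. card P = j \<and> card (\<Union>P) \<le> j * q + 2"
    using insert.IH insert.prems by (auto simp: pairwise_insert)
  have lK: "linked (\<lambda>A B. 2 \<le> card (A \<inter> B)) K" and dK: "card (\<Union>K) \<le> card K * q"
    using insert.prems by auto
  have fK: "finite K" using lK linked_finite by blast
  have fD: "finite (\<Union>\<D>)"
    using insert.prems(2) insert.hyps by (intro finite_Union) (auto dest: linked_finite)
  have disj: "\<Union>\<D> \<inter> K = {}"
    using insert.prems insert.hyps by (auto simp: pairwise_insert disjnt_def)
  have un: "\<Union>(Set.insert K \<D>) = \<Union>\<D> \<union> K" by auto
  have card: "card (\<Union>\<D> \<union> P) = card (\<Union>\<D>) + card P" if "P \<subseteq> K" for P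
    using that disj fD fK by (intro card_Un_disjoint) (auto intro: finite_subset)
  have span: "card (\<Union>(\<Union>\<D> \<union> P)) \<le> card (\<Union>\<D>) * q + card (\<Union>P)" for P
    using IH(1) card_Un_le[of "\<Union>(\<Union>\<D>)" "\<Union>P"] by (simp add: Union_Un_distrib)
  have "\<exists>P\<subseteq>\<Union>\<D> \<union> K. card P = j \<and> card (\<Union>P) \<le> j * q + 2" if j: "j \<le> card (\<Union>\<D> \<union> K)" for j
  proof (cases "j \<le> card (\<Union>\<D>)")
    case True
    then show ?thesis using IH(2) by blast
  next
    case False
    then obtain i where i: "j = card (\<Union>\<D>) + i" "0 < i"
      by (metis less_imp_add_positive not_le)
    then have "i \<le> card K" using j card[of K] by simp
    with i obtain P where P: "P \<subseteq> K" "linked (\<lambda>A B. 2 \<le> card (A \<inter> B)) P" "card P = i"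
      using linked_subset_card[OF lK] by blast
    have "card (\<Union>P) \<le> i * q + 2"
      using linked_Union_card_le[OF P(2)] P insert.prems by auto
    then have "card (\<Union>(\<Union>\<D> \<union> P)) \<le> j * q + 2"
      using span[of P] i by (simp add: add_mult_distrib)
    then show ?thesis using P card[of P] i by (intro exI[of _ "\<Union>\<D> \<union> P"]) auto
  qed
  moreover have "card (\<Union>(\<Union>\<D> \<union> K)) \<le> card (\<Union>\<D> \<union> K) * q"
    using span[of K] dK card[of K] by (simp add: add_mult_distrib)
  ultimately show ?case unfolding un by blast
qed

text \<open>The components of defect at least 2, collected in \<open>\<D>\<close>, have fewer than
  \<open>e\<close> edges in total, as otherwise \<open>e\<close> of these edges would span at most
  \<open>e * q + 2\<close> vertices; the last summand pays for them. Every other component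
  \<open>K\<close> satisfies \<open>linked_card_le_shadow2\<close>, and distinct components have
  disjoint shadows because their edges share at most one vertex.\<close>

lemma card_edges_le:
  assumes V: "finite V" and F: "F \<subseteq> nsets V (q + 2)"
    and free: "\<And>P. P \<subseteq> F \<Longrightarrow> card P = e \<Longrightarrow> e * q + 3 \<le> card (\<Union>P)" and e: "0 < e"
  shows "card F * ((q + 2) * (q + 1)) \<le> card V * (card V - 1) + 3 * card F + e * ((q + 2) * (q + 1))"
proof -
  let ?R = "\<lambda>A B::'a set. 2 \<le> card (A \<inter> B)"
  let ?p = "(q + 2) * (q + 1)"
  have fF: "finite F" using V F finite_imp_finite_nsets finite_subset by blast
  have uni: "finite A \<and> card A = q + 2" if "A \<in> F" for A
    using F that by (auto simp: nsets_def)
  obtain \<K> where part: "partition_on F \<K>" and lk: "\<forall>K\<in>\<K>. linked ?R K"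
    and sep: "\<forall>K\<in>\<K>. \<forall>L\<in>\<K>. K \<noteq> L \<longrightarrow> (\<forall>a\<in>K. \<forall>b\<in>L. \<not> ?R a b)"
    using linked_partition[OF fF, of ?R] by (auto simp: Int_commute)
  have f\<K>: "finite \<K>" using finite_elements[OF fF part] .
  have sub: "K \<subseteq> F" if "K \<in> \<K>" for K using partition_onD1[OF part] that by blast
  have dj: "disjoint \<K>" using partition_onD2[OF part] .
  define \<D> where "\<D> = {K\<in>\<K>. card (\<Union>K) \<le> card K * q}"
  have f\<D>: "finite \<D>" "\<D> \<subseteq> \<K>" using f\<K> by (auto simp: \<D>_def)
  have djD: "disjoint \<D>" using dj f\<D>(2) pairwise_subset by blast
  have ex: "\<forall>j \<le> card (\<Union>\<D>). \<exists>P\<subseteq>\<Union>\<D>. card P = j \<and> card (\<Union>P) \<le> j * q + 2"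
    using dense_linked_families_subset[OF f\<D>(1) djD, of q] lk sub uni
    unfolding \<D>_def by blast
  have DF: "\<Union>\<D> \<subseteq> F" using sub f\<D> by blast
  have "card (\<Union>\<D>) < e"
  proof (rule ccontr)
    assume "\<not> card (\<Union>\<D>) < e"
    then obtain P where "P \<subseteq> \<Union>\<D>" "card P = e" "card (\<Union>P) \<le> e * q + 2"
      using ex by (meson not_less)
    with free[of P] DF show False by fastforce
  qed
  then have D: "(\<Sum>K\<in>\<D>. card K) \<le> e"
    using card_Union_disjoint[OF djD] linked_finite lk f\<D> by (metis less_imp_le subsetD)
  have rest: "card K * ?p \<le> 2 * card (shadow2 K) + 3 * card K" if "K \<in> \<K> - \<D>" for K
    using that lk sub uni by (intro linked_card_le_shadow2) (auto simp: \<D>_def)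
  have "(\<Sum>K\<in>\<K>-\<D>. card (shadow2 K)) \<le> card (nsets V 2)"
  proof (rule sum_card_le_card_UN)
    show "finite (nsets V 2)" using V finite_imp_finite_nsets by blast
    show "finite (\<K> - \<D>)" using f\<K> by blast
    show "shadow2 K \<subseteq> nsets V 2" if "K \<in> \<K> - \<D>" for K
      using sub[of K] that F by (fastforce simp: shadow2_def nsets_def)
    show "shadow2 K \<inter> shadow2 L = {}" if "K \<in> \<K> - \<D>" "L \<in> \<K> - \<D>" "K \<noteq> L" for K L
    proof (rule ccontr)
      assume "shadow2 K \<inter> shadow2 L \<noteq> {}"
      then obtain A B p where *: "A \<in> K" "B \<in> L" "p \<subseteq> A \<inter> B" "card p = 2"
        by (auto simp: shadow2_def nsets_def)
      have "finite (A \<inter> B)" using uni sub that * by blast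
      then have "?R A B" using * card_mono by metis
      then show False using sep that * by blast
    qed
  qed
  moreover have "2 * card (nsets V 2) \<le> card V * (card V - 1)"
    by (simp add: card_nsets choose_two)
  ultimately have sh: "2 * (\<Sum>K\<in>\<K>-\<D>. card (shadow2 K)) \<le> card V * (card V - 1)" by linarith
  have cF: "card F = (\<Sum>K\<in>\<K>. card K)"
    using card_Union_disjoint[OF dj] linked_finite lk partition_onD1[OF part] by metis
  also have "\<dots> = (\<Sum>K\<in>\<K>-\<D>. card K) + (\<Sum>K\<in>\<D>. card K)"
    using sum.subset_diff[OF f\<D>(2) f\<K>] by simp
  finally have split: "card F = (\<Sum>K\<in>\<K>-\<D>. card K) + (\<Sum>K\<in>\<D>. card K)" .
  have "(\<Sum>K\<in>\<K>-\<D>. card K * ?p) \<le> (\<Sum>K\<in>\<K>-\<D>. 2 * card (shadow2 K) + 3 * card K)"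
    by (intro sum_mono rest)
  then have "(\<Sum>K\<in>\<K>-\<D>. card K) * ?p \<le> card V * (card V - 1) + 3 * (\<Sum>K\<in>\<K>-\<D>. card K)"
    using sh by (simp add: sum.distrib sum_distrib_left sum_distrib_right del: mult_Suc mult_Suc_right)
  moreover have "(\<Sum>K\<in>\<D>. card K) * ?p \<le> e * ?p" using D by (rule mult_le_mono1)
  moreover have "card F * ?p = (\<Sum>K\<in>\<K>-\<D>. card K) * ?p + (\<Sum>K\<in>\<D>. card K) * ?p"
    unfolding split by (rule add_mult_distrib)
  ultimately show ?thesis using split by linarith
qed

section \<open>Edges that meet a dense configuration\<close>

text \<open>A part with \<open>j\<close> edges that is linked outside of \<open>\<Union>S\<close> has \<open>j < e - k\<close>, since otherwise \<open>e - k\<close> of its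
  edges together with \<open>S\<close> span too little; then \<open>free'\<close> gives it \<open>j * q + 1\<close> vertices outside of \<open>\<Union>S\<close>.\<close>
lemma card_edges_touching_le:
  assumes V: "finite V" and F: "F \<subseteq> nsets V (q + 2)"
    and free: "\<And>P. P \<subseteq> F \<Longrightarrow> card P = e \<Longrightarrow> e * q + 3 \<le> card (\<Union>P)"
    and free': "\<And>P. P \<subseteq> F \<Longrightarrow> k < card P \<Longrightarrow> card P < e \<Longrightarrow> card P * q + 2 \<le> card (\<Union>P)"
    and S: "S \<subseteq> F" "card S = k" "card (\<Union>S) = k * q + 1" and k: "0 < k" "k < e"
    and one: "\<And>A. A \<in> F - S \<Longrightarrow> card (A \<inter> \<Union>S) \<le> 1"
  shows "card {A\<in>F - S. A \<inter> \<Union>S \<noteq> {}} * q \<le> card V"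
proof -
  define X where "X = \<Union>S"
  define G where "G = {A\<in>F - S. A \<inter> X \<noteq> {}}"
  \<comment> \<open>Common vertices inside \<open>X\<close> are ignored, so different components are
    disjoint outside of \<open>X\<close> even if they meet within it.\<close>
  let ?R = "\<lambda>A B. A \<inter> B - X \<noteq> {}"
  have fF: "finite F" using V F finite_imp_finite_nsets finite_subset by blast
  have fG: "finite G" using fF by (simp add: G_def)
  have fS: "finite S" using S fF finite_subset by blast
  have fX: "finite X" using S k card_gt_0_iff[of X] by (simp add: X_def)
  have fin: "finite A" and out: "card (A - X) = q + 1" if "A \<in> G" for A
  proof -
    have A: "finite A" "card A = q + 2" using F that by (auto simp: nsets_def G_def)
    have "card (A \<inter> X) \<le> 1" using that one by (auto simp: X_def G_def)
    moreover have "card (A \<inter> X) \<noteq> 0" using A that by (auto simp: G_def)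
    ultimately have "card (A \<inter> X) = 1" by linarith
    then show "card (A - X) = q + 1" using A card_Int_Diff[of A X] by simp
    show "finite A" by fact
  qed
  \<comment> \<open>Every edge of \<open>G\<close> has exactly one vertex in \<open>X\<close>. The
    first edge thus has \<open>q + 1\<close> vertices outside of \<open>X\<close>, and each later
    one adds at most \<open>q\<close>.\<close>
  have up: "P \<subseteq> G \<longrightarrow> card (\<Union>P - X) \<le> card P * q + 1" if "linked ?R P" for P
    using that
  proof (induction rule: linked.induct)
    case (single a)
    then show ?case using out by simp
  next
    case (insert P a b)
    have "card (\<Union>(Set.insert b P) - X) \<le> card (Set.insert b P) * q + 1" if sub: "Set.insert b P \<subseteq> G"
    proof -
      have fP: "finite P" using insert.hyps linked_finite by blast
      have f: "finite (\<Union>P - X)" "finite (b - X)" using fP sub fin by auto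
      have "(b - X) \<inter> (\<Union>P - X) \<noteq> {}" using insert.hyps by blast
      then have "1 \<le> card ((b - X) \<inter> (\<Union>P - X))"
        using f by (simp add: Suc_le_eq card_gt_0_iff)
      moreover have "card (b - X) + card (\<Union>P - X)
          = card ((b - X) \<union> (\<Union>P - X)) + card ((b - X) \<inter> (\<Union>P - X))"
        using card_Un_Int f by blast
      moreover have "(b - X) \<union> (\<Union>P - X) = \<Union>(Set.insert b P) - X" by blast
      moreover have "card (b - X) = q + 1" using sub out by simp
      moreover have "card (\<Union>P - X) \<le> card P * q + 1" using insert sub by simp
      ultimately show ?thesis using insert.hyps fP by simp
    qed
    then show ?case by blast
  qed
  have span: "card (S \<union> P) = k + card P \<and> card (\<Union>(S \<union> P)) = k * q + 1 + card (\<Union>P - X)"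
    if "P \<subseteq> G" for P
  proof
    have fP: "finite P" using that fG finite_subset by blast
    have "S \<inter> P = {}" using that by (auto simp: G_def)
    then show "card (S \<union> P) = k + card P" using card_Un_disjoint[OF fS fP] S by simp
    have fU: "finite (\<Union>P - X)" using fP fin that by auto
    have "\<Union>(S \<union> P) = X \<union> (\<Union>P - X)" by (auto simp: X_def)
    then show "card (\<Union>(S \<union> P)) = k * q + 1 + card (\<Union>P - X)"
      using card_Un_disjoint[OF fX fU] S by (simp add: X_def)
  qed
  have sF: "S \<union> P \<subseteq> F" if "P \<subseteq> G" for P using that S by (auto simp: G_def)
  have low: "card P * q \<le> card (\<Union>P - X)" if P: "linked ?R P" "P \<subseteq> G" for P
  proof -
    have small: "card P < e - k"
    proof (rule ccontr)
      assume "\<not> card P < e - k"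
      then obtain L where L: "L \<subseteq> P" "linked ?R L" "card L = e - k"
        using linked_subset_card[OF P(1), of "e - k"] k by auto
      then have LG: "L \<subseteq> G" using P by blast
      have "k + (e - k) = e" using k by simp
      then have "e * q + 3 \<le> k * q + 1 + card (\<Union>L - X)"
        using free[OF sF[OF LG]] span[OF LG] L by simp
      also have "\<dots> \<le> k * q + 1 + ((e - k) * q + 1)" using up[OF L(2)] LG L by simp
      also have "\<dots> = e * q + 2"
        using \<open>k + (e - k) = e\<close> add_mult_distrib[of k "e - k" q] by simp
      finally show False by simp
    qed
    have "0 < card P" using P linked_finite by (metis card_gt_0_iff empty_iff insert_not_empty linked.cases)
    then have "(k + card P) * q + 2 \<le> k * q + 1 + card (\<Union>P - X)"
      using free'[OF sF[OF P(2)]] span[OF P(2)] small by auto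
    then show ?thesis by (simp add: add_mult_distrib)
  qed
  obtain \<K> where part: "partition_on G \<K>" and lk: "\<forall>K\<in>\<K>. linked ?R K"
    and sep: "\<forall>K\<in>\<K>. \<forall>L\<in>\<K>. K \<noteq> L \<longrightarrow> (\<forall>a\<in>K. \<forall>b\<in>L. \<not> ?R a b)"
    using linked_partition[OF fG, of ?R] by (auto simp: Int_commute)
  have f\<K>: "finite \<K>" using finite_elements[OF fG part] .
  have sub: "K \<subseteq> G" if "K \<in> \<K>" for K using partition_onD1[OF part] that by blast
  have "card G = (\<Sum>K\<in>\<K>. card K)"
    using card_Union_disjoint[OF partition_onD2[OF part]] linked_finite lk partition_onD1[OF part] by metis
  then have "card G * q = (\<Sum>K\<in>\<K>. card K * q)" by (simp add: sum_distrib_right)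
  also have "\<dots> \<le> (\<Sum>K\<in>\<K>. card (\<Union>K - X))" using low lk sub by (intro sum_mono) blast
  also have "\<dots> \<le> card V"
  proof (rule sum_card_le_card_UN[OF V f\<K>])
    show "\<Union>K - X \<subseteq> V" if "K \<in> \<K>" for K
      using sub[OF that] F by (fastforce simp: G_def nsets_def)
    show "(\<Union>K - X) \<inter> (\<Union>L - X) = {}" if "K \<in> \<K>" "L \<in> \<K>" "K \<noteq> L" for K L
      using sep that by blast
  qed
  finally show ?thesis by (simp add: G_def X_def)
qed

text \<open>Each vertex of \<open>\<Union>S\<close> has degree at least \<open>e > k\<close>, hence
  lies on an edge outside of \<open>S\<close>. Adding such an edge to \<open>S\<close> must produce
  at least \<open>(k + 1) * q + 2\<close> vertices, which bounds \<open>card (\<Union>S)\<close>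
  from below and the intersections with other edges from above.\<close>

lemma dense_configuration_edges:
  assumes V: "finite V" and F: "F \<subseteq> nsets V (q + 2)"
    and free: "\<And>P. P \<subseteq> F \<Longrightarrow> card P = e \<Longrightarrow> e * q + 3 \<le> card (\<Union>P)"
    and free': "\<And>P. P \<subseteq> F \<Longrightarrow> k < card P \<Longrightarrow> card P < e \<Longrightarrow> card P * q + 2 \<le> card (\<Union>P)"
    and S: "S \<subseteq> F" "card S = k" "card (\<Union>S) \<le> k * q + 1" and k: "2 \<le> k" "k + 1 < e"
    and deg: "\<And>x. x \<in> V \<Longrightarrow> e \<le> vertex_degree F x"
  shows "card (\<Union>S) = k * q + 1" "q + 3 \<le> card (\<Union>S)"
    "card {A\<in>F. A \<inter> \<Union>S \<noteq> {}} * q \<le> card V + k * q"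
proof -
  define X where "X = \<Union>S"
  have uni: "finite A \<and> card A = q + 2 \<and> A \<subseteq> V" if "A \<in> F" for A
    using F that by (auto simp: nsets_def)
  have fF: "finite F" using V F finite_imp_finite_nsets finite_subset by blast
  have fS: "finite S" using S fF finite_subset by blast
  have XV: "X \<subseteq> V" using S uni by (auto simp: X_def)
  have fX: "finite X" using XV V finite_subset by blast
  \<comment> \<open>After cancellation this reads
    \<open>k * q + card (A \<inter> X) \<le> card X\<close>. Both the lower bound on
    \<open>card X\<close> and \<open>one\<close> come from it.\<close>
  have add: "(k + 1) * q + 2 + card (A \<inter> X) \<le> q + 2 + card X" if "A \<in> F - S" for A
  proof -
    have "card (insert A S) = k + 1" using that S fS by simp
    then have "(k + 1) * q + 2 \<le> card (A \<union> X)"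
      using free'[of "insert A S"] that S k by (simp add: X_def)
    moreover have "card A + card X = card (A \<union> X) + card (A \<inter> X)"
      using card_Un_Int[of A X] uni that fX by blast
    ultimately show ?thesis using uni[of A] that by simp
  qed
  obtain A B where AB: "A \<in> S" "B \<in> S" "A \<noteq> B"
    using k S by (metis card_le_Suc0_iff_eq fS not_less_eq_eq numeral_2_eq_2)
  have "A \<subset> X"
  proof
    show "A \<subseteq> X" using AB by (auto simp: X_def)
    show "A \<noteq> X"
    proof
      assume "A = X"
      then have "B \<subseteq> A" using AB by (auto simp: X_def)
      moreover have "A \<in> F" "B \<in> F" using S AB by auto
      then have "card B = card A" "finite A" using uni by simp_all
      ultimately show False using AB card_subset_eq by metis
    qed
  qed
  then have "card A < card X" using fX psubset_card_mono by blast
  then show "q + 3 \<le> card (\<Union>S)" using uni[of A] S AB by (auto simp: X_def)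
  obtain x where x: "x \<in> X" using \<open>A \<subset> X\<close> by blast
  have "\<not> {A \<in> F. x \<in> A} \<subseteq> S"
  proof
    assume "{A \<in> F. x \<in> A} \<subseteq> S"
    then have "vertex_degree F x \<le> k" unfolding vertex_degree_def
      using S fS card_mono by metis
    then show False using deg[of x] x XV k by auto
  qed
  then obtain D where D: "D \<in> F - S" "x \<in> D" by blast
  have "finite (D \<inter> X)" using fX by blast
  then have "card (D \<inter> X) \<noteq> 0" using D x by auto
  then have low: "k * q + 1 \<le> card X" using add[OF D(1)] by simp
  then show cX: "card (\<Union>S) = k * q + 1" using S by (simp add: X_def)
  have one: "card (A \<inter> \<Union>S) \<le> 1" if "A \<in> F - S" for A
    using add[OF that] S by (simp add: X_def)
  have "card {A\<in>F - S. A \<inter> \<Union>S \<noteq> {}} * q \<le> card V"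
    using card_edges_touching_le[OF V F free free' S(1,2) cX _ _ one] k by auto
  moreover have "card {A\<in>F. A \<inter> \<Union>S \<noteq> {}} \<le> card {A\<in>F - S. A \<inter> \<Union>S \<noteq> {}} + card S"
    using card_Un_le[of "{A\<in>F - S. A \<inter> \<Union>S \<noteq> {}}" S]
      card_mono[of "{A\<in>F - S. A \<inter> \<Union>S \<noteq> {}} \<union> S" "{A\<in>F. A \<inter> \<Union>S \<noteq> {}}"] fF fS by fastforce
  then have "card {A\<in>F. A \<inter> \<Union>S \<noteq> {}} * q \<le> (card {A\<in>F - S. A \<inter> \<Union>S \<noteq> {}} + card S) * q"
    by (rule mult_le_mono1)
  ultimately show "card {A\<in>F. A \<inter> \<Union>S \<noteq> {}} * q \<le> card V + k * q"
    using S by (simp add: add_mult_distrib)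
qed

section \<open>Reformulation of freeness, and numerical inequalities\<close>

text \<open>With \<open>r = q + 2\<close> the span bound \<open>i * r - 2 * (i - 1)\<close> is
  \<open>i * q + 2\<close>; truncated subtraction breaks this for \<open>i = 0\<close>.\<close>

lemma G_free_dense_iff:
  assumes "0 < i"
  shows "G_free (i * (q + 2) - 2 * (i - 1) - 1) i F \<longleftrightarrow> (\<forall>S\<subseteq>F. card S = i \<longrightarrow> i * q + 2 \<le> card (\<Union>S))"
    and "G_free (i * (q + 2) - 2 * (i - 1)) i F \<longleftrightarrow> (\<forall>S\<subseteq>F. card S = i \<longrightarrow> i * q + 3 \<le> card (\<Union>S))"
proof -
  obtain j where "i = Suc j" using assms gr0_conv_Suc by blast
  then have "i * (q + 2) - 2 * (i - 1) = i * q + 2" by (simp add: algebra_simps)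
  then show "G_free (i * (q + 2) - 2 * (i - 1) - 1) i F \<longleftrightarrow> (\<forall>S\<subseteq>F. card S = i \<longrightarrow> i * q + 2 \<le> card (\<Union>S))"
    and "G_free (i * (q + 2) - 2 * (i - 1)) i F \<longleftrightarrow> (\<forall>S\<subseteq>F. card S = i \<longrightarrow> i * q + 3 \<le> card (\<Union>S))"
    unfolding G_free_def by (auto simp: numeral_3_eq_3)
qed

text \<open>Here \<open>c\<close> is the first term of the density assumption, \<open>C\<close> is
  the density bound from \<open>card_edges_le\<close>, and the fraction is \<open>alpha\<close>
  squared. After clearing denominators and substituting \<open>x = s + 4\<close>, each difference is
  a polynomial in \<open>s \<ge> 0\<close> with positive coefficients.\<close>

lemma slope_inequality:
  fixes x :: real
  assumes "4 \<le> x"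
  defines "\<kappa> \<equiv> 1 / ((x - 2) * (4 * x - 7))"
    and "c \<equiv> 1 / (x * (x - 1)) - 1 / ((3 * x - 4) * (x - 1) + 1) / (x * (x - 2))"
    and "C \<equiv> 1 / (x * (x - 1) - 3)"
  shows "\<kappa> < c" "\<kappa> < C"
    "(3 * x ^ 2 - 4 * x - 14) / (3 * x ^ 2 + 2 * x - 8) * (C - \<kappa>) \<le> c - \<kappa>"
proof -
  define s where "s = x - 4"
  have x: "x = s + 4" and s: "0 \<le> s" using assms(1) by (auto simp: s_def)
  define kD where "kD = (x - 2) * (4 * x - 7)"
  define CD where "CD = x * (x - 1) - 3"
  define d where "d = (3 * x - 4) * (x - 1) + 1"
  define cN where "cN = (x - 2) * d - (x - 1)"
  define cD where "cD = x * (x - 1) * ((x - 2) * d)"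
  define aN where "aN = 3 * x ^ 2 - 4 * x - 14"
  define aD where "aD = 3 * x ^ 2 + 2 * x - 8"
  have "d = 3 * s ^ 2 + 17 * s + 25" "CD = s ^ 2 + 7 * s + 9" "aD = 3 * s ^ 2 + 26 * s + 48"
    unfolding d_def CD_def aD_def x by algebra+
  then have "0 < d" "0 < CD" "0 < aD" using s by (auto intro: add_nonneg_pos)
  moreover have "0 < kD" "0 < cD" using s \<open>0 < d\<close> by (simp_all add: kD_def cD_def x)
  ultimately have pos: "0 < kD" "0 < CD" "0 < d" "0 < cD" "0 < aD" by auto
  have \<kappa>: "\<kappa> = 1 / kD" and C: "C = 1 / CD" by (simp_all add: \<kappa>_def kD_def C_def CD_def)
  have "1 / (x * (x - 1)) = (x - 2) * d / cD" "1 / d / (x * (x - 2)) = (x - 1) / cD"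
    using assms(1) \<open>0 < d\<close> by (simp_all add: cD_def)
  then have c: "c = cN / cD"
    unfolding c_def d_def[symmetric] cN_def by (simp add: diff_divide_distrib)
  have "cN * kD - cD = 246 + 785 * s + 849 * s ^ 2 + 421 * s ^ 3 + 99 * s ^ 4 + 9 * s ^ 5"
    unfolding cN_def kD_def cD_def d_def x by algebra
  also have "\<dots> > 0" using s by (intro add_pos_nonneg) auto
  finally have 1: "0 < cN * kD - cD" .
  have "kD - CD = 9 + 10 * s + 3 * s ^ 2" unfolding kD_def CD_def x by algebra
  also have "\<dots> > 0" using s by (intro add_pos_nonneg) auto
  finally have 2: "0 < kD - CD" .
  have "aD * CD * (cN * kD - cD) - aN * (kD - CD) * cD = 9072 + 91944 * s + 208242 * s ^ 2
      + 220299 * s ^ 3 + 130997 * s ^ 4 + 46479 * s ^ 5 + 9772 * s ^ 6 + 1122 * s ^ 7 + 54 * s ^ 8"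
    unfolding aD_def CD_def cN_def kD_def cD_def aN_def d_def x by algebra
  also have "\<dots> \<ge> 0" using s by (intro add_nonneg_nonneg) auto
  finally have 3: "aN * (kD - CD) * cD \<le> (cN * kD - cD) * (aD * CD)" by (simp add: mult.commute)
  have c\<kappa>: "c - \<kappa> = (cN * kD - cD) / (cD * kD)" and C\<kappa>: "C - \<kappa> = (kD - CD) / (CD * kD)"
    unfolding c \<kappa> C using pos by (auto simp: field_simps)
  have "c - \<kappa> > 0" "C - \<kappa> > 0" unfolding c\<kappa> C\<kappa> using 1 2 pos by simp_all
  then show "\<kappa> < c" "\<kappa> < C" by simp_all
  have "aN * (kD - CD) / (aD * CD) \<le> (cN * kD - cD) / cD"
    using 3 pos by (simp add: frac_le_eq divide_le_eq pos_le_divide_eq mult.commute mult.left_commute)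
  then have "aN * (kD - CD) / (aD * CD) / kD \<le> (cN * kD - cD) / cD / kD"
    using pos by (intro divide_right_mono) auto
  then show "(3 * x ^ 2 - 4 * x - 14) / (3 * x ^ 2 + 2 * x - 8) * (C - \<kappa>) \<le> c - \<kappa>"
    unfolding c\<kappa> C\<kappa> aN_def[symmetric] aD_def[symmetric] by (simp add: mult.assoc)
qed

lemma alpha_square:
  "3 \<le> r \<Longrightarrow> alpha r ^ 2 = (3 * real r ^ 2 - 4 * real r - 14) / (3 * real r ^ 2 + 2 * real r - 8)"
proof -
  assume "3 \<le> r"
  \<comment> \<open>The two quadratics exceed these products by 1 and by 25.\<close>
  then have "0 \<le> (real r - 3) * (3 * real r + 5)" "0 \<le> (real r - 3) * (3 * real r + 11)" by auto
  then have "0 \<le> 3 * real r ^ 2 - 4 * real r - 14" "0 \<le> 3 * real r ^ 2 + 2 * real r - 8"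
    by (auto simp: algebra_simps power2_eq_square)
  then show ?thesis unfolding alpha_def by (intro real_sqrt_pow2) simp
qed

text \<open>The last condition says \<open>\<kappa> > 1 / 8\<close> for \<open>r = 3\<close> and \<open>\<kappa> > 1 / ((r - 2) * (4 * r - 6))\<close> for
  \<open>r \<ge> 4\<close>; the witnesses are slightly larger than that.\<close>
lemma exists_slope:
  fixes r :: nat and c :: real
  assumes "3 \<le> r"
    and "max (1 / (real r * (real r - 1)) - delta r / (real r * (real r - 2)))
      (1 / (2 * real r ^ 2 - 2 * real r - 5)) = c"
  shows "\<exists>\<kappa>>0. \<kappa> < c \<and> \<kappa> < 1 / (real r * (real r - 1) - 3) \<and>
    alpha r ^ 2 * (1 / (real r * (real r - 1) - 3) - \<kappa>) \<le> c - \<kappa> \<and>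
    1 / (real r - 2) < 2 * \<kappa> * max (real r + 1) (2 * real r - 3)"
proof (cases "r = 3")
  case True
  \<comment> \<open>For \<open>r = 3\<close> the second term of the maximum equals 1/7; the case
    \<open>r \<ge> 4\<close> works with the first term.\<close>
  then have "1 / 7 \<le> c" using assms by auto
  then show ?thesis unfolding alpha_square[OF assms(1)]
    by (intro exI[of _ "2 / 15"]) (simp add: True power2_eq_square)
next
  case False
  define x where "x = real r"
  then have x: "4 \<le> x" using assms False by simp
  have c: "1 / (x * (x - 1)) - 1 / ((3 * x - 4) * (x - 1) + 1) / (x * (x - 2)) \<le> c"
    using assms(2) by (auto simp: x_def delta_def)
  define \<kappa> where "\<kappa> = 1 / ((x - 2) * (4 * x - 7))"
  have "0 < \<kappa>" using x by (simp add: \<kappa>_def)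
  have "1 < (4 * x - 6) / (4 * x - 7)" using x by simp
  then have "1 / (x - 2) < (4 * x - 6) / (4 * x - 7) / (x - 2)"
    using x by (intro divide_strict_right_mono) auto
  also have "\<dots> = 2 * \<kappa> * (2 * x - 3)" by (simp add: \<kappa>_def field_simps)
  also have "\<dots> \<le> 2 * \<kappa> * max (x + 1) (2 * x - 3)" using \<open>0 < \<kappa>\<close> by simp
  finally have "1 / (x - 2) < 2 * \<kappa> * max (x + 1) (2 * x - 3)" .
  then show ?thesis
    using slope_inequality[OF x] c \<open>0 < \<kappa>\<close> unfolding alpha_square[OF assms(1)] x_def[symmetric]
    by (intro exI[of _ \<kappa>]) (auto simp: \<kappa>_def)
qed

section \<open>The minimal subhypergraph and its properties\<close>

theorem lemma10:
  fixes r e :: nat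
  assumes "r \<ge> 3"
  shows "\<exists>N::nat. \<forall>(t::nat) (n::nat) (F :: nat set set).
    n \<ge> N \<longrightarrow> 3 \<le> t \<longrightarrow> t \<le> e - 1 \<longrightarrow>
    r_graph r {1..n} F \<longrightarrow>
    G_free (e * r - 2 * (e - 1)) e F \<longrightarrow>
    (\<forall>i. t \<le> i \<and> i \<le> e - 1 \<longrightarrow> G_free (i * r - 2 * (i - 1) - 1) i F) \<longrightarrow>
    (\<forall>x \<in> {1..n}. vertex_degree F x = 0 \<or> vertex_degree F x \<ge> e) \<longrightarrow>
    real (card F) / real n ^ 2 \<ge>
      max (1 / (real r * (real r - 1)) - delta r / (real r * (real r - 2)))
          (1 / (2 * real r ^ 2 - 2 * real r - 5)) \<longrightarrow>
    (\<exists>V' F'. subhypergraph r V' F' {1..n} F \<and>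
       G_free ((t - 1) * r - 2 * (t - 2) - 1) (t - 1) F' \<and>
       real (card V') \<ge> alpha r * real n \<and>
       real (card F') / real (card V') ^ 2 \<ge> real (card F) / real n ^ 2)"
proof -
  obtain q where r: "r = q + 2" and q: "1 \<le> q"
    using assms by (intro that[of "r - 2"]) auto
  define c where "c = max (1 / (real r * (real r - 1)) - delta r / (real r * (real r - 2)))
    (1 / (2 * real r ^ 2 - 2 * real r - 5))"
  define C where "C = 1 / (real r * (real r - 1) - 3)"
  \<comment> \<open>A lower bound for the number of vertices of a dense configuration: two distinct
    edges span at least \<open>q + 3 = r + 1\<close>, and \<open>k * q + 1 \<ge> 2 * r - 3\<close>
    for \<open>k \<ge> 2\<close>.\<close>
  define \<mu> where "\<mu> = max (real r + 1) (2 * real r - 3)"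
  obtain \<kappa> where \<kappa>: "0 < \<kappa>" "\<kappa> < c" "\<kappa> < C" "alpha r ^ 2 * (C - \<kappa>) \<le> c - \<kappa>"
    and slope: "1 / (real r - 2) < 2 * \<kappa> * \<mu>"
    using exists_slope[OF assms c_def[symmetric]] unfolding C_def \<mu>_def by blast
  \<comment> \<open>The surplus per remaining vertex when a dense configuration is deleted:
    \<open>\<kappa>\<close> times the square drops at a rate of at least
    \<open>2 * \<kappa> * \<mu>\<close>, while at most about \<open>1 / q\<close> edges per vertex
    are lost.\<close>
  define \<eta> where "\<eta> = 2 * \<kappa> * \<mu> - 1 / q"
  have \<eta>: "0 < \<eta>" using slope by (simp add: \<eta>_def r)
  \<comment> \<open>The bounds on \<open>M\<close> serve, in order, positivity, the deletion of a
    vertex of small degree, the deletion of a dense configuration, and the absorption of the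
    additive term of \<open>card_edges_le\<close>. They involve \<open>e\<close> instead of
    \<open>t\<close>, so that \<open>N\<close> does not depend on \<open>t\<close>.\<close>
  obtain M :: nat where "max (max 1 (e / \<kappa> + 1))
      (max ((\<kappa> * real (e * r) ^ 2 + e) / \<eta>) (real (e * ((q + 2) * (q + 1))))) \<le> real M"
    using real_arch_simple by blast
  then have M: "1 \<le> real M" "e / \<kappa> + 1 \<le> M" "(\<kappa> * real (e * r) ^ 2 + e) / \<eta> \<le> M"
    "real (e * ((q + 2) * (q + 1))) \<le> M" by simp_all
  obtain N :: nat where N: "2 ^ M / (c - \<kappa>) < real N"
    using reals_Archimedean2 by blast
  show ?thesis
  proof (intro exI[of _ N] allI impI)
    fix t n :: nat and F :: "nat set set"
    assume n: "N \<le> n" and t: "3 \<le> t" "t \<le> e - 1" and rF: "r_graph r {1..n} F"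
      and freee: "G_free (e * r - 2 * (e - 1)) e F"
      and freei: "\<forall>i. t \<le> i \<and> i \<le> e - 1 \<longrightarrow> G_free (i * r - 2 * (i - 1) - 1) i F"
      and dens: "max (1 / (real r * (real r - 1)) - delta r / (real r * (real r - 2)))
          (1 / (2 * real r ^ 2 - 2 * real r - 5)) \<le> real (card F) / real n ^ 2"
    define c0 where "c0 = real (card F) / real n ^ 2"
    have c0: "c \<le> c0" using dens by (simp add: c_def c0_def)
    have "0 < 2 ^ M / (c - \<kappa>)" using \<kappa> by simp
    then have n0: "0 < n" using n N by (cases n) auto
    then have cF: "real (card F) = c0 * real n ^ 2" by (simp add: c0_def)
    have FV: "F \<subseteq> nsets {1..n} (q + 2)" using rF by (simp add: r_graph_def r)
    have e: "4 \<le> e" using t by linarith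
    have free: "e * q + 3 \<le> card (\<Union>P)" if "P \<subseteq> F" "card P = e" for P
      using G_free_dense_iff(2)[of e q F] freee that e by (simp add: r)
    have free': "card P * q + 2 \<le> card (\<Union>P)" if "P \<subseteq> F" "t - 1 < card P" "card P < e" for P
    proof -
      have "t \<le> card P \<and> card P \<le> e - 1" "0 < card P" using that by auto
      then show ?thesis
        using G_free_dense_iff(1)[of "card P" q F] freei[rule_format, of "card P"] that
        unfolding r by blast
    qed
    define Q where "Q = (\<lambda>(V', F'). V' \<subseteq> {1..n} \<and> F' \<subseteq> F \<and> F' \<subseteq> nsets V' (q + 2) \<and>
      \<kappa> * real (card V') ^ 2 + (c0 - \<kappa>) * real n ^ 2 \<le> real (card F'))"
    have "Q ({1..n}, F)" using FV by (simp add: Q_def cF algebra_simps)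
    then obtain V' F' where VF: "Q (V', F')"
      and min: "\<And>V'' F''. Q (V'', F'') \<Longrightarrow> card V' \<le> card V''"
      using ex_has_least_nat[of Q "({1..n}, F)" "\<lambda>(V, _). card V"] by (auto split: prod.splits)
    have V': "V' \<subseteq> {1..n}" and F'F: "F' \<subseteq> F" and F'V: "F' \<subseteq> nsets V' (q + 2)"
      and big: "\<kappa> * real (card V') ^ 2 + (c0 - \<kappa>) * real n ^ 2 \<le> real (card F')"
      using VF by (auto simp: Q_def)
    have fV: "finite V'" using V' finite_subset by blast
    have fF: "finite F'" using fV F'V finite_imp_finite_nsets finite_subset by blast
    have F'free: "e * q + 3 \<le> card (\<Union>P)" if "P \<subseteq> F'" "card P = e" for P
      using free F'F that by blast
    have F'free': "card P * q + 2 \<le> card (\<Union>P)" if "P \<subseteq> F'" "t - 1 < card P" "card P < e" for P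
      using free' F'F that by blast
    define v where "v = real (card V')"
    \<comment> \<open>The minimal pair still has at least \<open>(c0 - \<kappa>) * n^2\<close>
      edges, more than \<open>2 ^ M\<close>, whereas \<open>v\<close> vertices carry at most
      \<open>2 ^ v\<close> edges.\<close>
    have Mv: "real M < v"
    proof -
      have "2 ^ M / (c - \<kappa>) < real n"
        using n N by linarith
      also have "real n \<le> real n ^ 2" using n0 by (simp add: power2_eq_square)
      finally have "2 ^ M < real n ^ 2 * (c - \<kappa>)" using \<kappa> by (simp add: pos_divide_less_eq)
      also have "\<dots> \<le> real n ^ 2 * (c0 - \<kappa>)" using c0 by (intro mult_left_mono) auto
      also have "\<dots> \<le> real (card F')"
      proof -
        have "0 \<le> \<kappa> * real (card V') ^ 2" using \<kappa>(1) by simp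
        then have "(c0 - \<kappa>) * real n ^ 2 \<le> real (card F')" using big by linarith
        then show ?thesis by (simp only: mult.commute)
      qed
      also have "\<dots> \<le> real (card (Pow V'))"
        using F'V fV by (intro of_nat_mono card_mono) (auto simp: nsets_def)
      also have "\<dots> = 2 ^ card V'" using fV by (simp add: card_Pow)
      finally show ?thesis unfolding v_def using power_less_imp_less_exp[of 2 M "card V'"] by simp
    qed
    \<comment> \<open>The left side is the decrease of \<open>\<kappa> * v^2\<close> when
      \<open>X\<close> is deleted. If at most that many edges were lost, the smaller pair would also
      satisfy \<open>Q\<close>.\<close>
    have no_gain: "\<kappa> * (2 * v * card X - real (card X) ^ 2) < card {A\<in>F'. A \<inter> X \<noteq> {}}"
      if X: "X \<subseteq> V'" "X \<noteq> {}" for X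
    proof (rule ccontr)
      assume "\<not> ?thesis"
      then have le: "card {A\<in>F'. A \<inter> X \<noteq> {}} \<le> \<kappa> * (2 * v * card X - real (card X) ^ 2)" by simp
      have un: "{A\<in>F'. A \<inter> X = {}} \<union> {A\<in>F'. A \<inter> X \<noteq> {}} = F'" by blast
      have "card F' \<le> card {A\<in>F'. A \<inter> X = {}} + card {A\<in>F'. A \<inter> X \<noteq> {}}"
        using card_Un_le[of "{A\<in>F'. A \<inter> X = {}}" "{A\<in>F'. A \<inter> X \<noteq> {}}"] by (simp only: un)
      moreover have cX: "card X \<le> card V'" "card X > 0"
        using X fV by (auto intro: card_mono simp: card_gt_0_iff finite_subset)
      moreover have cD: "card (V' - X) = card V' - card X"
        using X fV by (simp add: card_Diff_subset finite_subset)
      moreover have "real (card (V' - X)) = v - card X" using cX cD by (simp add: v_def)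
      ultimately have "\<kappa> * real (card (V' - X)) ^ 2 + (c0 - \<kappa>) * real n ^ 2 \<le> card {A\<in>F'. A \<inter> X = {}}"
        using le big by (simp add: v_def[symmetric] power2_eq_square algebra_simps)
      moreover have "{A\<in>F'. A \<inter> X = {}} \<subseteq> nsets (V' - X) (q + 2)"
        using F'V by (auto simp: nsets_def)
      ultimately have "Q (V' - X, {A\<in>F'. A \<inter> X = {}})"
        using V' F'F by (auto simp: Q_def)
      from min[OF this] show False using cX cD by simp
    qed
    have deg: "e \<le> vertex_degree F' x" if "x \<in> V'" for x
    proof (rule ccontr)
      assume "\<not> ?thesis"
      then have "real (card {A\<in>F'. A \<inter> {x} \<noteq> {}}) \<le> e" by (simp add: vertex_degree_def)
      then have "\<kappa> * (2 * v - 1) < e" using no_gain[of "{x}"] that by simp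
      moreover have "e \<le> \<kappa> * (real M - 1)" using M(2) \<kappa> by (simp add: field_simps)
      moreover have "\<kappa> * (real M - 1) \<le> \<kappa> * (2 * v - 1)" using Mv \<kappa> by (intro mult_left_mono) auto
      ultimately show False by linarith
    qed
    have "(t - 1) * q + 2 \<le> card (\<Union>S)" if S: "S \<subseteq> F'" "card S = t - 1" for S
    proof (rule ccontr)
      assume "\<not> ?thesis"
      then have le: "card (\<Union>S) \<le> (t - 1) * q + 1" by simp
      have k: "2 \<le> t - 1" "t - 1 + 1 < e" using t by auto
      note dense = dense_configuration_edges[OF fV F'V F'free F'free' S le k deg]
      have cX: "card (\<Union>S) = (t - 1) * q + 1" "q + 3 \<le> card (\<Union>S)" by (rule dense; assumption)+
      have touch: "card {A\<in>F'. A \<inter> \<Union>S \<noteq> {}} * q \<le> card V' + (t - 1) * q"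
        by (rule dense; assumption)
      define m where "m = real (card (\<Union>S))"
      have "2 * q + 1 \<le> card (\<Union>S)" using cX(1) mult_le_mono1[OF k(1), of q] by linarith
      then have "real (2 * q + 1) \<le> m" unfolding m_def by (rule of_nat_mono)
      then have \<mu>: "\<mu> \<le> m" using cX(2) by (simp add: \<mu>_def r m_def)
      have "(t - 1) * q \<le> e * q" using t by (intro mult_le_mono1) simp
      then have "card (\<Union>S) \<le> e * q + e" using cX(1) e by linarith
      then have "card (\<Union>S) \<le> e * r" by (simp add: r algebra_simps)
      then have me: "m \<le> real (e * r)" unfolding m_def by (rule of_nat_mono)
      have "\<Union>S \<subseteq> V'" using S F'V by (fastforce simp: nsets_def)
      moreover have "\<Union>S \<noteq> {}" using cX(1) by (metis card.empty Suc_eq_plus1 nat.distinct(1))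
      ultimately have "\<kappa> * (2 * v * m - m ^ 2) < card {A\<in>F'. A \<inter> \<Union>S \<noteq> {}}"
        using no_gain unfolding m_def by blast
      also have "\<dots> \<le> v / q + (t - 1)"
      proof -
        have "real (card {A\<in>F'. A \<inter> \<Union>S \<noteq> {}}) * q \<le> v + real (t - 1) * q"
          using of_nat_mono[OF touch, where 'a = real] by (simp add: v_def)
        then show ?thesis using q by (simp add: field_simps)
      qed
      also have "\<dots> \<le> v / q + e" using t by simp
      \<comment> \<open>The left side grows linearly in \<open>v\<close>, by at least
        \<open>\<eta> * v\<close>, while the right side is bounded in terms of \<open>e\<close> and
        \<open>r\<close>.\<close>
      finally have "2 * \<kappa> * m * v - v / q < \<kappa> * m ^ 2 + e" by (simp add: algebra_simps)
      also have "\<dots> \<le> \<kappa> * real (e * r) ^ 2 + e"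
        using me \<kappa> by (intro add_right_mono mult_left_mono power_mono) (auto simp: m_def)
      also have "\<dots> \<le> \<eta> * M" using M(3) \<eta> by (simp add: field_simps)
      also have "\<dots> \<le> \<eta> * v" using Mv \<eta> by simp
      also have "\<dots> \<le> (2 * \<kappa> * m - 1 / q) * v"
        unfolding \<eta>_def using \<mu> \<kappa> Mv by (intro mult_right_mono diff_right_mono mult_left_mono) auto
      finally show False by (simp add: algebra_simps)
    qed
    then have "G_free ((t - 1) * r - 2 * (t - 2) - 1) (t - 1) F'"
      using G_free_dense_iff(1)[of "t - 1" q F'] t by (simp add: r numeral_2_eq_2)
    moreover have "subhypergraph r V' F' {1..n} F"
      using V' F'F F'V fV by (simp add: subhypergraph_def r_graph_def r)
    \<comment> \<open>Since \<open>v\<close> exceeds \<open>e * ((q + 2) * (q + 1))\<close>, the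
      additive term fits into the gap between \<open>v * (v - 1)\<close> and \<open>v^2\<close>, so
      \<open>card F' \<le> C * v^2\<close>. Against the lower bound \<open>big\<close> this forces
      \<open>v\<close> to be large.\<close>
    moreover have "alpha r * real n \<le> v"
    proof -
      have "card F' * ((q + 2) * (q + 1)) \<le> card V' * (card V' - 1) + 3 * card F' + e * ((q + 2) * (q + 1))"
        using card_edges_le[OF fV F'V F'free] e by simp
      moreover have "e * ((q + 2) * (q + 1)) \<le> card V'" using M(4) Mv unfolding v_def by linarith
      ultimately have "card F' * ((q + 2) * (q + 1)) \<le> card V' * card V' + 3 * card F'"
        by (cases "card V'") auto
      then have "real (card F' * ((q + 2) * (q + 1))) \<le> real (card V' * card V' + 3 * card F')"
        by (rule of_nat_mono)
      then have "real (card F') * (real r * (real r - 1) - 3) \<le> v ^ 2"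
        by (simp add: r v_def algebra_simps power2_eq_square)
      moreover have "0 < real r * (real r - 1) - 3"
        using \<kappa> unfolding C_def by (smt (verit) zero_less_divide_1_iff)
      ultimately have "real (card F') \<le> C * v ^ 2" by (simp add: C_def pos_le_divide_eq)
      then have "(c0 - \<kappa>) * real n ^ 2 \<le> (C - \<kappa>) * v ^ 2"
        using big by (simp add: v_def[symmetric] algebra_simps)
      moreover have "(c - \<kappa>) * real n ^ 2 \<le> (c0 - \<kappa>) * real n ^ 2"
        using c0 by (intro mult_right_mono) auto
      moreover have "alpha r ^ 2 * (C - \<kappa>) * real n ^ 2 \<le> (c - \<kappa>) * real n ^ 2"
        using \<kappa>(4) by (intro mult_right_mono) auto
      ultimately have "(C - \<kappa>) * (alpha r * real n) ^ 2 \<le> (C - \<kappa>) * v ^ 2"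
        by (simp add: power_mult_distrib mult_ac)
      then have "(alpha r * real n) ^ 2 \<le> v ^ 2" using \<kappa>(3) by simp
      then show ?thesis by (rule power2_le_imp_le) (simp add: v_def)
    qed
    \<comment> \<open>As \<open>\<kappa> < c0\<close> and \<open>v \<le> n\<close>, replacing
      \<open>n\<close> by \<open>v\<close> in \<open>big\<close> only weakens it, and the terms with
      \<open>\<kappa>\<close> cancel.\<close>
    moreover have "c0 \<le> real (card F') / v ^ 2"
    proof -
      have "v \<le> n" using V' card_mono[of "{1..n}" V'] by (simp add: v_def)
      then have "(c0 - \<kappa>) * v ^ 2 \<le> (c0 - \<kappa>) * real n ^ 2"
        using c0 \<kappa> by (intro mult_left_mono power_mono) (auto simp: v_def)
      then have "c0 * v ^ 2 \<le> real (card F')"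
        using big by (simp add: v_def[symmetric] algebra_simps)
      moreover have "0 < v" using Mv M by linarith
      ultimately show ?thesis by (simp add: pos_le_divide_eq)
    qed
    ultimately show "\<exists>V' F'. subhypergraph r V' F' {1..n} F \<and>
       G_free ((t - 1) * r - 2 * (t - 2) - 1) (t - 1) F' \<and>
       real (card V') \<ge> alpha r * real n \<and>
       real (card F') / real (card V') ^ 2 \<ge> real (card F) / real n ^ 2"
      unfolding v_def c0_def by blast
  qed
qed

end
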